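(* Assume that the feedback control $U(t)=U(X(t),\widehat\Phi(t))$ is admissible and that it grows at most linearly in $X(t)$ (i.e. there is a constant $K$ with $|U(x,\varphi)|\le K(1+|x|)$ for all $x\in\mathbb R^n$ and all $\varphi$ in the probability simplex of $\mathbb R^m$). Then the feedback control system $$d\begin{pmatrix}X(t)\\ \widehat\Phi(t)\end{pmatrix}=\begin{pmatrix}C(X(t))\widehat\Phi(t)\\ \Pi'\widehat\Phi(t)\end{pmatrix}dt+\begin{pmatrix}I_n\\ D(\widehat\Phi(t))C(X(t))'\end{pmatrix}dV(t)$$ is regular, that is, with $Y(t)=(X(t),\widehat\Phi(t))'$, for every $0<T<\infty$, $$\mathbb P\Big(\sup_{0\le t\le T}|Y(t)|=\infty\Big)=0 .$$
   Context: A prime denotes transpose; $|v|$ is the Euclidean norm of a vector and $|A|=\sqrt{\mathrm{tr}(AA')}$ for a matrix. On a probability space $(\Omega,\mathcal A,\mathbb P)$, $\alpha(t)$ is a continuous-time Markov chain with finite state space $\mathcal M=\{1,\dots,m\}$ and transition rate matrix $\Pi=(\pi_{ij})\in\mathbb R^{m\times m}$, and $W(t)$ is a standard $\mathbb R^n$-valued Brownian motion. For $i\in\mathcal M$, $A_i\in\mathbb R^{n\times n}$ and $B_i\in\mathbb R^{n\times d}$. The state $X(t)\in\mathbb R^n$ and control $U(t)\in\mathbb R^d$ satisfy $$dX(t)=[A_{\alpha(t)}X(t)+B_{\alpha(t)}U(t)]\,dt+dW(t),$$ with square integrable initial condition $X(0)=x$; the initial condition, $\alpha(\cdot)$ and $W(\cdot)$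 are mutually independent. $X$ is observed, $\alpha$ is not. Let $\mathcal F^X_t=\sigma\{X(s):s\le t\}$. A control is admissible if $U(t)$ is $\mathcal F^X_t$-measurable for each $t\ge0$. The Wonham filter is $\widehat\Phi(t)=(\widehat\Phi_1(t),\dots,\widehat\Phi_m(t))'$ with $\widehat\Phi_i(t)=\mathbb E[1_{\{\alpha(t)=i\}}\mid\mathcal F^X_t]$, so $\widehat\Phi_i(t)\ge0$ and $\sum_i\widehat\Phi_i(t)=1$. With a feedback control $U(t)=U(X(t),\widehat\Phi(t))$, set $$C(X(t))=(A_1X(t)+B_1U(t),\dots,A_mX(t)+B_mU(t))\in\mathbb R^{n\times m},$$ $D(\varphi)=\mathrm{diag}(\varphi_1,\dots,\varphi_m)-\varphi\varphi'$ for $\varphi\in\mathbb R^m$; $I_n$ is the identity matrix. The innovation process $V$ (driving Brownian motion) is defined by $dV(t)=dX(t)-C(X(t))\widehat\Phi(t)\,dt$. With this notation $(X,\widehat\Phi)$ satisfies the displayed system in the claim. *)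

theory Defs
  imports "HOL-Probability.Probability"
begin

section \<open>Stacked vectors and matrices\<close>

text \<open>Vertical stacking, \<open>(v', w')'\<close>.  Matrices are vectors of rows, so the same function
  stacks two matrices with equally many columns.\<close>

definition stack :: "'a ^ 'n \<Rightarrow> 'a ^ 'm \<Rightarrow> 'a ^ ('n + 'm)" where
  "stack v w = (\<chi> k. case k of Inl i \<Rightarrow> v $ i | Inr j \<Rightarrow> w $ j)"


section \<open>Brownian motion and Markov chains\<close>

text \<open>A process is a function of type \<open>real \<Rightarrow> 'w \<Rightarrow> 'a\<close>, used only at times \<open>t \<ge> 0\<close>.\<close>

definition natural_filtration ::
    "'w measure \<Rightarrow> 'a measure \<Rightarrow> (real \<Rightarrow> 'w \<Rightarrow> 'a) \<Rightarrow> real \<Rightarrow> 'w measure" where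
  "natural_filtration M N Z t =
     sigma (space M) {Z s -` E \<inter> space M | s E. 0 \<le> s \<and> s \<le> t \<and> E \<in> sets N}"

definition process_algebra ::
    "'w measure \<Rightarrow> 'a measure \<Rightarrow> (real \<Rightarrow> 'w \<Rightarrow> 'a) \<Rightarrow> 'w measure" where
  "process_algebra M N Z =
     sigma (space M) {Z s -` E \<inter> space M | s E. 0 \<le> s \<and> E \<in> sets N}"

text \<open>Standard Brownian motion relative to a filtration \<open>G\<close>; the increment over \<open>[s, t]\<close> is
  \<open>N(0, (t - s) I)\<close>.\<close>

definition brownian_motion ::
    "'w measure \<Rightarrow> (real \<Rightarrow> 'w measure) \<Rightarrow> (real \<Rightarrow> 'w \<Rightarrow> real ^ 'n) \<Rightarrow> bool" where
  "brownian_motion M G W \<longleftrightarrow>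
     (\<forall>t\<ge>0. W t \<in> borel_measurable M \<and> W t \<in> borel_measurable (G t)) \<and>
     (AE \<omega> in M. W 0 \<omega> = 0) \<and>
     (AE \<omega> in M. continuous_on {0..} (\<lambda>t. W t \<omega>)) \<and>
     (\<forall>s t. 0 \<le> s \<and> s < t \<longrightarrow>
        distributed M lborel (\<lambda>\<omega>. W t \<omega> - W s \<omega>)
          (\<lambda>x. ennreal (\<Prod>i\<in>UNIV. normal_density 0 (sqrt (t - s)) (x $ i))) \<and>
        prob_space.indep_set M (sets (G s))
          (sets (vimage_algebra (space M) (\<lambda>\<omega>. W t \<omega> - W s \<omega>) borel)))"

definition rate_matrix :: "real ^ 'm ^ 'm \<Rightarrow> bool" where
  "rate_matrix Q \<longleftrightarrow>
     (\<forall>i j. i \<noteq> j \<longrightarrow> 0 \<le> Q $ i $ j) \<and> (\<forall>i. (\<Sum>j\<in>UNIV. Q $ i $ j) = 0)"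

definition transition_semigroup :: "real ^ 'm ^ 'm \<Rightarrow> (real \<Rightarrow> real ^ 'm ^ 'm) \<Rightarrow> bool" where
  "transition_semigroup Q P \<longleftrightarrow>
     (\<forall>t\<ge>0. (\<forall>i j. 0 \<le> P t $ i $ j) \<and> (\<forall>i. (\<Sum>j\<in>UNIV. P t $ i $ j) = 1)) \<and>
     P 0 = mat 1 \<and>
     (\<forall>s\<ge>0. \<forall>t\<ge>0. P (s + t) = P s ** P t) \<and>
     (P has_vector_derivative Q) (at 0 within {0..})"

text \<open>The last two conjuncts say that almost all paths are right continuous with left limits
  in the discrete topology of the state space.\<close>

definition markov_chain ::
    "'w measure \<Rightarrow> real ^ 'm ^ 'm \<Rightarrow> (real \<Rightarrow> 'w \<Rightarrow> 'm::finite) \<Rightarrow> bool" where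
  "markov_chain M Q \<alpha> \<longleftrightarrow>
     rate_matrix Q \<and>
     (\<forall>t\<ge>0. \<alpha> t \<in> measurable M (count_space UNIV)) \<and>
     (\<exists>P. transition_semigroup Q P \<and>
        (\<forall>s\<ge>0. \<forall>t\<ge>0. \<forall>i j. \<forall>F\<in>sets (natural_filtration M (count_space UNIV) \<alpha> s).
           measure M (F \<inter> {\<omega>\<in>space M. \<alpha> s \<omega> = i \<and> \<alpha> (s + t) \<omega> = j}) =
           measure M (F \<inter> {\<omega>\<in>space M. \<alpha> s \<omega> = i}) * P t $ i $ j)) \<and>
     (AE \<omega> in M. \<forall>t\<ge>0. \<exists>e>0. \<forall>s. t \<le> s \<and> s < t + e \<longrightarrow> \<alpha> s \<omega> = \<alpha> t \<omega>) \<and>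
     (AE \<omega> in M. \<forall>t>0. \<exists>e>0. \<exists>i. \<forall>s. 0 \<le> s \<and> t - e < s \<and> s < t \<longrightarrow> \<alpha> s \<omega> = i)"

definition mutually_independent ::
    "'w measure \<Rightarrow> ('w \<Rightarrow> real ^ 'n) \<Rightarrow> (real \<Rightarrow> 'w \<Rightarrow> 'm) \<Rightarrow> (real \<Rightarrow> 'w \<Rightarrow> real ^ 'n) \<Rightarrow> bool" where
  "mutually_independent M \<xi> \<alpha> W \<longleftrightarrow>
     prob_space.indep_sets M
       (\<lambda>k::nat. [sets (vimage_algebra (space M) \<xi> borel),
                  sets (process_algebra M (count_space UNIV) \<alpha>),
                  sets (process_algebra M borel W)] ! k) {0, 1, 2}"


section \<open>Stochastic differential equations up to an explosion time\<close>

text \<open>Solutions may a priori explode.  A process with lifetime \<open>\<zeta> :: 'w \<Rightarrow> ereal\<close> is meaningful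
  only at times \<open>t < \<zeta>\<close>; values of the underlying function at later times are never used.\<close>

text \<open>\<open>\<sigma>{X s | s \<le> t}\<close>, where the events \<open>{s < \<zeta>}\<close> are observed too (take \<open>E = UNIV\<close>).\<close>

definition observation ::
    "'w measure \<Rightarrow> ('w \<Rightarrow> ereal) \<Rightarrow> (real \<Rightarrow> 'w \<Rightarrow> real ^ 'n) \<Rightarrow> real \<Rightarrow> 'w measure" where
  "observation M \<zeta> X t =
     sigma (space M)
       {{\<omega>\<in>space M. ereal s < \<zeta> \<omega> \<and> X s \<omega> \<in> E} | s E. 0 \<le> s \<and> s \<le> t \<and> E \<in> sets borel}"

definition step_data ::
    "'w measure \<Rightarrow> (real \<Rightarrow> 'w measure) \<Rightarrow>
     nat \<Rightarrow> (nat \<Rightarrow> real) \<Rightarrow> (nat \<Rightarrow> 'w \<Rightarrow> real ^ 'n ^ 'k) \<Rightarrow> bool" where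
  "step_data M G N \<tau> \<eta> \<longleftrightarrow>
     0 \<le> \<tau> 0 \<and> (\<forall>j<N. \<tau> j \<le> \<tau> (Suc j)) \<and>
     (\<forall>j<N. \<eta> j \<in> borel_measurable (G (\<tau> j))) \<and>
     (\<exists>c. \<forall>j<N. \<forall>\<omega>\<in>space M. norm (\<eta> j \<omega>) \<le> c)"

definition step_process ::
    "nat \<Rightarrow> (nat \<Rightarrow> real) \<Rightarrow> (nat \<Rightarrow> 'w \<Rightarrow> real ^ 'n ^ 'k) \<Rightarrow> real \<Rightarrow> 'w \<Rightarrow> real ^ 'n ^ 'k" where
  "step_process N \<tau> \<eta> s \<omega> = (\<Sum>j<N. indicator {\<tau> j<..\<tau> (Suc j)} s *\<^sub>R \<eta> j \<omega>)"

definition step_integral ::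
    "(real \<Rightarrow> 'w \<Rightarrow> real ^ 'n) \<Rightarrow> nat \<Rightarrow> (nat \<Rightarrow> real) \<Rightarrow> (nat \<Rightarrow> 'w \<Rightarrow> real ^ 'n ^ 'k) \<Rightarrow>
     real \<Rightarrow> 'w \<Rightarrow> real ^ 'k" where
  "step_integral V N \<tau> \<eta> t \<omega> =
     (\<Sum>j<N. \<eta> j \<omega> *v (V (min t (\<tau> (Suc j))) \<omega> - V (min t (\<tau> j)) \<omega>))"

text \<open>\<open>J = \<integral> H dV\<close> on \<open>[0, \<zeta>)\<close> for a \<open>G\<close>-Brownian motion \<open>V\<close>.  The usual definition takes step
  processes with \<open>\<integral>\<^sub>0\<^sup>t |H - S\<^sub>l|\<^sup>2 ds \<rightarrow> 0\<close> in probability and lets \<open>J t\<close> be the limit in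
  probability of their elementary integrals; passing to a subsequence makes both limits almost
  sure.  If \<open>{t < \<zeta>} \<in> G t\<close>, restricting the convergence to \<open>{t < \<zeta>}\<close> replaces localisation by
  stopping times: stopping at the first time at which \<open>\<integral> |S\<^sub>l - S\<^sub>k|\<^sup>2\<close> exceeds \<open>\<delta>\<close> shows that
  \<open>J\<close> is determined on \<open>[0, \<zeta>)\<close> up to indistinguishability.\<close>

definition ito_integral ::
    "'w measure \<Rightarrow> (real \<Rightarrow> 'w measure) \<Rightarrow> (real \<Rightarrow> 'w \<Rightarrow> real ^ 'n) \<Rightarrow> ('w \<Rightarrow> ereal) \<Rightarrow>
     (real \<Rightarrow> 'w \<Rightarrow> real ^ 'n ^ 'k) \<Rightarrow> (real \<Rightarrow> 'w \<Rightarrow> real ^ 'k) \<Rightarrow> bool" where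
  "ito_integral M G V \<zeta> H J \<longleftrightarrow>
     (AE \<omega> in M. continuous_on {t. 0 \<le> t \<and> ereal t < \<zeta> \<omega>} (\<lambda>t. J t \<omega>)) \<and>
     (\<forall>t\<ge>0. \<exists>N \<tau> \<eta>.
        (\<forall>l::nat. step_data M G (N l) (\<tau> l) (\<eta> l)) \<and>
        (AE \<omega> in M. ereal t < \<zeta> \<omega> \<longrightarrow>
           set_borel_measurable lborel {0..t} (\<lambda>s. H s \<omega>) \<and>
           (\<forall>l. set_integrable lborel {0..t}
                  (\<lambda>s. (norm (H s \<omega> - step_process (N l) (\<tau> l) (\<eta> l) s \<omega>))\<^sup>2)) \<and>
           (\<lambda>l. LINT s:{0..t}|lborel.
                  (norm (H s \<omega> - step_process (N l) (\<tau> l) (\<eta> l) s \<omega>))\<^sup>2) \<longlonglongrightarrow> 0 \<and>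
           (\<lambda>l. step_integral V (N l) (\<tau> l) (\<eta> l) t \<omega>) \<longlonglongrightarrow> J t \<omega>))"

text \<open>\<open>dY = b dt + \<sigma> dV\<close> on \<open>[0, \<zeta>)\<close>.\<close>

definition has_ito_differential ::
    "'w measure \<Rightarrow> (real \<Rightarrow> 'w measure) \<Rightarrow> (real \<Rightarrow> 'w \<Rightarrow> real ^ 'n) \<Rightarrow> ('w \<Rightarrow> ereal) \<Rightarrow>
     (real \<Rightarrow> 'w \<Rightarrow> real ^ 'k) \<Rightarrow> (real \<Rightarrow> 'w \<Rightarrow> real ^ 'n ^ 'k) \<Rightarrow>
     (real \<Rightarrow> 'w \<Rightarrow> real ^ 'k) \<Rightarrow> bool" where
  "has_ito_differential M G V \<zeta> b \<sigma> Y \<longleftrightarrow>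
     (AE \<omega> in M. continuous_on {t. 0 \<le> t \<and> ereal t < \<zeta> \<omega>} (\<lambda>t. Y t \<omega>)) \<and>
     (\<exists>J. ito_integral M G V \<zeta> \<sigma> J \<and>
        (AE \<omega> in M. \<forall>t. 0 \<le> t \<and> ereal t < \<zeta> \<omega> \<longrightarrow>
           set_integrable lborel {0..t} (\<lambda>s. b s \<omega>) \<and>
           Y t \<omega> = Y 0 \<omega> + (LINT s:{0..t}|lborel. b s \<omega>) + J t \<omega>))"

text \<open>The lifetime is the explosion time of \<open>Y\<close>: it is positive, and a path can end at a finite
  time only by becoming unbounded.\<close>

definition explosion_time ::
    "'w measure \<Rightarrow> (real \<Rightarrow> 'w \<Rightarrow> real ^ 'k) \<Rightarrow> ('w \<Rightarrow> ereal) \<Rightarrow> bool" where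
  "explosion_time M Y \<zeta> \<longleftrightarrow>
     \<zeta> \<in> borel_measurable M \<and>
     (AE \<omega> in M. 0 < \<zeta> \<omega> \<and>
        (\<zeta> \<omega> < \<infinity> \<longrightarrow> (SUP t\<in>{t. 0 \<le> t \<and> ereal t < \<zeta> \<omega>}. ereal (norm (Y t \<omega>))) = \<infinity>))"

text \<open>\<open>P (sup {|Y t| | 0 \<le> t \<le> T} = \<infinity>) = 0\<close> for all \<open>T\<close>, where \<open>|Y t| = \<infinity>\<close> from the explosion
  time on.  The \<open>AE\<close> form puts the event inside a null set, hence asserts no less than
  \<open>measure M _ = 0\<close>, which would hold trivially for a non-measurable set.\<close>

definition exploding_norm ::
    "('w \<Rightarrow> ereal) \<Rightarrow> (real \<Rightarrow> 'w \<Rightarrow> real ^ 'k) \<Rightarrow> real \<Rightarrow> 'w \<Rightarrow> ereal" where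
  "exploding_norm \<zeta> Y t \<omega> = (if ereal t < \<zeta> \<omega> then ereal (norm (Y t \<omega>)) else \<infinity>)"

definition regular :: "'w measure \<Rightarrow> ('w \<Rightarrow> ereal) \<Rightarrow> (real \<Rightarrow> 'w \<Rightarrow> real ^ 'k) \<Rightarrow> bool" where
  "regular M \<zeta> Y \<longleftrightarrow>
     (\<forall>T>0. AE \<omega> in M. \<not> (SUP t\<in>{0..T}. exploding_norm \<zeta> Y t \<omega>) = \<infinity>)"


section \<open>The partially observed control system\<close>

definition prob_simplex :: "(real ^ 'm) set" where
  "prob_simplex = {\<phi>. (\<forall>i. 0 \<le> \<phi> $ i) \<and> (\<Sum>i\<in>UNIV. \<phi> $ i) = 1}"

definition linear_growth :: "(real ^ 'n \<Rightarrow> real ^ 'm \<Rightarrow> real ^ 'd) \<Rightarrow> bool" where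
  "linear_growth u \<longleftrightarrow> (\<exists>K. \<forall>x. \<forall>\<phi>\<in>prob_simplex. norm (u x \<phi>) \<le> K * (1 + norm x))"

text \<open>Since \<open>{t < \<zeta>}\<close> is in \<open>observation M \<zeta> X t\<close>, the value after explosion is immaterial.\<close>

definition admissible ::
    "'w measure \<Rightarrow> ('w \<Rightarrow> ereal) \<Rightarrow> (real \<Rightarrow> 'w \<Rightarrow> real ^ 'n) \<Rightarrow> (real \<Rightarrow> 'w \<Rightarrow> real ^ 'd) \<Rightarrow> bool" where
  "admissible M \<zeta> X U \<longleftrightarrow>
     (\<forall>t\<ge>0. (\<lambda>\<omega>. if ereal t < \<zeta> \<omega> then U t \<omega> else 0) \<in> borel_measurable (observation M \<zeta> X t))"

text \<open>\<open>dX = [A\<^sub>\<alpha> X + B\<^sub>\<alpha> U] dt + dW\<close> on \<open>[0, \<zeta>)\<close> with \<open>X 0 = \<xi>\<close>.\<close>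

definition state_equation ::
    "'w measure \<Rightarrow> ('m \<Rightarrow> real ^ 'n ^ 'n) \<Rightarrow> ('m \<Rightarrow> real ^ 'd ^ 'n) \<Rightarrow> (real \<Rightarrow> 'w \<Rightarrow> 'm) \<Rightarrow>
     (real \<Rightarrow> 'w \<Rightarrow> real ^ 'n) \<Rightarrow> ('w \<Rightarrow> real ^ 'n) \<Rightarrow> ('w \<Rightarrow> ereal) \<Rightarrow>
     (real \<Rightarrow> 'w \<Rightarrow> real ^ 'd) \<Rightarrow> (real \<Rightarrow> 'w \<Rightarrow> real ^ 'n) \<Rightarrow> bool" where
  "state_equation M A B \<alpha> W \<xi> \<zeta> U X \<longleftrightarrow>
     (\<forall>t\<ge>0. X t \<in> borel_measurable M) \<and>
     (AE \<omega> in M. X 0 \<omega> = \<xi> \<omega>) \<and>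
     (AE \<omega> in M. \<forall>t. 0 \<le> t \<and> ereal t < \<zeta> \<omega> \<longrightarrow>
        set_integrable lborel {0..t} (\<lambda>s. A (\<alpha> s \<omega>) *v X s \<omega> + B (\<alpha> s \<omega>) *v U s \<omega>) \<and>
        X t \<omega> = \<xi> \<omega> +
          (LINT s:{0..t}|lborel. A (\<alpha> s \<omega>) *v X s \<omega> + B (\<alpha> s \<omega>) *v U s \<omega>) + W t \<omega>)"

definition wonham_filter ::
    "'w measure \<Rightarrow> (real \<Rightarrow> 'w \<Rightarrow> 'm::finite) \<Rightarrow> ('w \<Rightarrow> ereal) \<Rightarrow> (real \<Rightarrow> 'w \<Rightarrow> real ^ 'n) \<Rightarrow>
     (real \<Rightarrow> 'w \<Rightarrow> real ^ 'm) \<Rightarrow> bool" where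
  "wonham_filter M \<alpha> \<zeta> X \<Phi> \<longleftrightarrow>
     (\<forall>t\<ge>0. \<forall>i.
        (\<lambda>\<omega>. \<Phi> t \<omega> $ i) \<in> borel_measurable (observation M \<zeta> X t) \<and>
        (AE \<omega> in M. \<Phi> t \<omega> $ i =
           real_cond_exp M (observation M \<zeta> X t) (indicator {\<omega>. \<alpha> t \<omega> = i}) \<omega>))"

definition C_matrix ::
    "('m \<Rightarrow> real ^ 'n ^ 'n) \<Rightarrow> ('m \<Rightarrow> real ^ 'd ^ 'n) \<Rightarrow> real ^ 'n \<Rightarrow> real ^ 'd \<Rightarrow> real ^ 'm ^ 'n" where
  "C_matrix A B x v = (\<chi> r i. (A i *v x + B i *v v) $ r)"

definition D_matrix :: "real ^ 'm \<Rightarrow> real ^ 'm ^ 'm" where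
  "D_matrix \<phi> = (\<chi> i j. (if i = j then \<phi> $ i else 0) - \<phi> $ i * \<phi> $ j)"

text \<open>\<open>V 0 = 0\<close> and \<open>dV = dX - C(X) \<Phi> dt\<close> on \<open>[0, \<zeta>)\<close>.\<close>

definition innovation_equation ::
    "'w measure \<Rightarrow> ('m::finite \<Rightarrow> real ^ 'n ^ 'n) \<Rightarrow> ('m \<Rightarrow> real ^ 'd ^ 'n) \<Rightarrow> ('w \<Rightarrow> ereal) \<Rightarrow>
     (real \<Rightarrow> 'w \<Rightarrow> real ^ 'd) \<Rightarrow> (real \<Rightarrow> 'w \<Rightarrow> real ^ 'n) \<Rightarrow> (real \<Rightarrow> 'w \<Rightarrow> real ^ 'm) \<Rightarrow>
     (real \<Rightarrow> 'w \<Rightarrow> real ^ 'n) \<Rightarrow> bool" where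
  "innovation_equation M A B \<zeta> U X \<Phi> V \<longleftrightarrow>
     (AE \<omega> in M. \<forall>t. 0 \<le> t \<and> ereal t < \<zeta> \<omega> \<longrightarrow>
        set_integrable lborel {0..t} (\<lambda>s. C_matrix A B (X s \<omega>) (U s \<omega>) *v \<Phi> s \<omega>) \<and>
        V t \<omega> = X t \<omega> - X 0 \<omega> -
          (LINT s:{0..t}|lborel. C_matrix A B (X s \<omega>) (U s \<omega>) *v \<Phi> s \<omega>))"

text \<open>The filtration of \<open>X\<close> and \<open>V\<close>.  Up to null sets \<open>V\<close> is determined by \<open>X\<close> before the
  explosion time; \<open>V\<close> is added so that a driving Brownian motion, which lives on \<open>[0, \<infinity>)\<close>, can be
  adapted beyond it.\<close>

definition driving_filtration ::
    "'w measure \<Rightarrow> ('w \<Rightarrow> ereal) \<Rightarrow> (real \<Rightarrow> 'w \<Rightarrow> real ^ 'n) \<Rightarrow> (real \<Rightarrow> 'w \<Rightarrow> real ^ 'n) \<Rightarrow>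
     real \<Rightarrow> 'w measure" where
  "driving_filtration M \<zeta> X V t =
     sigma (space M) (sets (observation M \<zeta> X t) \<union> sets (natural_filtration M borel V t))"

end

theory Submission
  imports Defs
begin

text \<open>The noise in the state equation \<open>dX = [A\<^sub>\<alpha> X + B\<^sub>\<alpha> U] dt + dW\<close> is additive, so regularity is a
  statement about single paths and needs no stochastic calculus.  The components of \<open>\<Phi> t\<close> are
  conditional probabilities of the events \<open>{\<alpha> t = i}\<close>, so \<open>\<Phi> t\<close> lies almost surely in the
  probability simplex; by path continuity almost surely this holds for all \<open>t < \<zeta>\<close>
  simultaneously (\<open>wonham_filter_prob_simplex_path\<close>).  Hence the feedback has linear growth along
  almost every path, the drift is at most \<open>c (1 + |X|)\<close>, and
  \<open>|X t| \<le> |\<xi>| + sup\<^sub>s\<^sub>\<le>\<^sub>T |W s| + c \<integral>\<^sub>0\<^sup>t (1 + |X s|) ds\<close> for \<open>t < \<zeta>\<close>, \<open>t \<le> T\<close>.  Gronwall's inequality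
  bounds \<open>|X|\<close>, and with it \<open>|Y|\<close>, on \<open>[0, T] \<inter> [0, \<zeta>)\<close> (\<open>additive_noise_path_bound\<close>).  A path with
  \<open>\<zeta> < \<infinity>\<close> would be unbounded before \<open>\<zeta>\<close>, so \<open>\<zeta> = \<infinity>\<close> almost surely, and then the same bound says that
  \<open>sup\<^sub>t\<^sub>\<le>\<^sub>T |Y t| < \<infinity>\<close>.\<close>

section \<open>Gronwall's inequality\<close>

lemma gronwall_integral:
  fixes g :: "real \<Rightarrow> real"
  assumes "0 \<le> T" "0 \<le> c" and g: "continuous_on {0..T} g"
    and le: "\<And>t. 0 \<le> t \<Longrightarrow> t \<le> T \<Longrightarrow> g t \<le> a + c * integral {0..t} g"
  shows "g T \<le> a * exp (c * T)"
proof -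
  \<comment> \<open>The right-hand side of the hypothesis, discounted at rate \<open>c\<close>; it is nonincreasing.\<close>
  define F where "F t = exp (- (c * t)) * (a + c * integral {0..t} g)" for t
  have "F T \<le> F 0"
  proof (rule DERIV_nonpos_imp_decreasing_open[OF \<open>0 \<le> T\<close>])
    fix t assume t: "0 < t" "t < T"
    have "((\<lambda>t. integral {0..t} g) has_real_derivative g t) (at t within {0..T})"
      using t by (intro integral_has_real_derivative g) auto
    then have "((\<lambda>t. integral {0..t} g) has_real_derivative g t) (at t)"
      using t by (simp add: at_within_Icc_at)
    then have "(F has_real_derivative exp (- (c * t)) * c * (g t - (a + c * integral {0..t} g))) (at t)"
      unfolding F_def by (auto intro!: derivative_eq_intros simp: algebra_simps)
    moreover have "exp (- (c * t)) * c * (g t - (a + c * integral {0..t} g)) \<le> 0"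
      using le[of t] t \<open>0 \<le> c\<close> by (intro mult_nonneg_nonpos) auto
    ultimately show "\<exists>y. (F has_real_derivative y) (at t) \<and> y \<le> 0" by blast
  next
    show "continuous_on {0..T} F"
      unfolding F_def
      by (intro continuous_intros indefinite_integral_continuous_1 integrable_continuous_real g)
  qed
  then have "exp (- (c * T)) * (a + c * integral {0..T} g) \<le> a"
    by (simp add: F_def)
  then have "a + c * integral {0..T} g \<le> a * exp (c * T)"
    by (simp add: exp_minus field_simps)
  with le[of T] \<open>0 \<le> T\<close> show ?thesis by simp
qed

section \<open>Stacked vectors, the simplex and the growth of the drift\<close>

lemma norm_stack_le: "norm (stack v w) \<le> norm v + norm w" for v :: "real ^ 'n" and w :: "real ^ 'm"
proof -
  have "(norm (stack v w))\<^sup>2 = (norm v)\<^sup>2 + (norm w)\<^sup>2"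
    by (simp add: norm_vec_def L2_set_def sum_nonneg UNIV_Plus_UNIV[symmetric] sum.Plus stack_def
        del: UNIV_Plus_UNIV)
  also have "\<dots> \<le> (norm v + norm w)\<^sup>2"
    by (simp add: power2_sum)
  finally show ?thesis by (rule power2_le_imp_le) simp
qed

lemma continuous_on_stackD:
  fixes f :: "real \<Rightarrow> real ^ 'n" and g :: "real \<Rightarrow> real ^ 'm"
  assumes "continuous_on S (\<lambda>t. stack (f t) (g t))"
  shows "continuous_on S f" "continuous_on S g"
proof -
  have "continuous_on S (\<lambda>t. \<chi> i. stack (f t) (g t) $ Inl i)"
    by (intro continuous_on_vec_lambda continuous_on_component assms)
  then show "continuous_on S f" by (simp add: stack_def)
  have "continuous_on S (\<lambda>t. \<chi> i. stack (f t) (g t) $ Inr i)"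
    by (intro continuous_on_vec_lambda continuous_on_component assms)
  then show "continuous_on S g" by (simp add: stack_def)
qed

lemma closed_prob_simplex: "closed (prob_simplex :: (real ^ 'm) set)"
proof -
  have "prob_simplex = (\<Inter>i. {\<phi> :: real ^ 'm. 0 \<le> \<phi> $ i}) \<inter> {\<phi>. (\<Sum>i\<in>UNIV. \<phi> $ i) = 1}"
    by (auto simp: prob_simplex_def)
  also have "closed \<dots>"
    by (intro closed_Int closed_INT ballI closed_Collect_le closed_Collect_eq continuous_intros)
  finally show ?thesis .
qed

lemma norm_prob_simplex_le: "\<phi> \<in> prob_simplex \<Longrightarrow> norm \<phi> \<le> 1"
  using norm_le_l1_cart[of \<phi>] by (simp add: prob_simplex_def)

text \<open>One constant \<open>c\<close> serves all regimes \<open>i\<close>, since there are finitely many; the path of the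
  Markov chain then plays no role in the estimate.\<close>

lemma drift_linear_growth:
  fixes A :: "'m::finite \<Rightarrow> real ^ 'n ^ 'n" and B :: "'m \<Rightarrow> real ^ 'd ^ 'n"
    and u :: "real ^ 'n \<Rightarrow> real ^ 'm \<Rightarrow> real ^ 'd"
  assumes "linear_growth u"
  obtains c where "0 \<le> c"
    and "\<And>i x \<phi>. \<phi> \<in> prob_simplex \<Longrightarrow> norm (A i *v x + B i *v u x \<phi>) \<le> c * (1 + norm x)"
proof -
  obtain K where K: "\<And>x \<phi>. \<phi> \<in> prob_simplex \<Longrightarrow> norm (u x \<phi>) \<le> K * (1 + norm x)"
    using assms by (auto simp: linear_growth_def)
  define a where "a = (\<Sum>i\<in>UNIV. onorm ((*v) (A i)))"
  define b where "b = (\<Sum>i\<in>UNIV. onorm ((*v) (B i)))"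
  have pos: "0 \<le> onorm ((*v) (A i))" "0 \<le> onorm ((*v) (B i))" for i
    by (simp_all add: onorm_pos_le)
  have le: "onorm ((*v) (A i)) \<le> a" "onorm ((*v) (B i)) \<le> b" for i
    unfolding a_def b_def by (rule member_le_sum; simp add: pos)+
  have nn: "0 \<le> a" "0 \<le> b" using pos le order_trans by blast+
  show thesis
  proof (rule that)
    show "0 \<le> a + b * \<bar>K\<bar>" using nn by simp
    fix i :: 'm and x :: "real ^ 'n" and \<phi> :: "real ^ 'm"
    assume \<phi>: "\<phi> \<in> prob_simplex"
    have "norm (A i *v x) \<le> onorm ((*v) (A i)) * norm x"
      by (rule onorm) simp
    also have "\<dots> \<le> a * (1 + norm x)"
      using le nn by (intro mult_mono) auto
    finally have 1: "norm (A i *v x) \<le> a * (1 + norm x)" .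
    \<comment> \<open>The constant in \<open>linear_growth\<close> is not required to be nonnegative.\<close>
    have "norm (u x \<phi>) \<le> \<bar>K\<bar> * (1 + norm x)"
      using K[OF \<phi>, of x] by (smt (verit) mult_right_mono norm_ge_zero)
    then have "onorm ((*v) (B i)) * norm (u x \<phi>) \<le> b * (\<bar>K\<bar> * (1 + norm x))"
      using le nn by (intro mult_mono) auto
    moreover have "norm (B i *v u x \<phi>) \<le> onorm ((*v) (B i)) * norm (u x \<phi>)"
      by (rule onorm) simp
    ultimately have 2: "norm (B i *v u x \<phi>) \<le> b * (\<bar>K\<bar> * (1 + norm x))" by linarith
    show "norm (A i *v x + B i *v u x \<phi>) \<le> (a + b * \<bar>K\<bar>) * (1 + norm x)"
      using 1 2 norm_triangle_ineq[of "A i *v x" "B i *v u x \<phi>"] by (simp add: algebra_simps)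
  qed
qed

section \<open>The filter stays in the probability simplex\<close>

lemma subalgebra_observation:
  fixes X :: "real \<Rightarrow> 'w \<Rightarrow> real ^ 'n"
  assumes [measurable]: "\<zeta> \<in> borel_measurable M" "\<And>t. 0 \<le> t \<Longrightarrow> X t \<in> borel_measurable M"
  shows "subalgebra M (observation M \<zeta> X t)"
proof -
  have "{\<omega>\<in>space M. ereal s < \<zeta> \<omega> \<and> X s \<omega> \<in> E} \<in> sets M"
    if "0 \<le> s" and [measurable]: "E \<in> sets borel" for s E
  proof -
    have [measurable]: "X s \<in> borel_measurable M" using that assms by simp
    show ?thesis by measurable
  qed
  then show ?thesis
    unfolding subalgebra_def observation_def
    by (subst space_measure_of_conv, subst sets_measure_of) (auto intro!: sets.sigma_sets_subset)
qed

lemma wonham_filter_prob_simplex: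
  fixes \<alpha> :: "real \<Rightarrow> 'w \<Rightarrow> 'm::finite" and X :: "real \<Rightarrow> 'w \<Rightarrow> real ^ 'n"
  assumes "prob_space M" "\<zeta> \<in> borel_measurable M"
    and "\<And>t. 0 \<le> t \<Longrightarrow> X t \<in> borel_measurable M"
    and \<alpha>: "\<alpha> t \<in> measurable M (count_space UNIV)"
    and filt: "wonham_filter M \<alpha> \<zeta> X \<Phi>" and t: "0 \<le> t"
  shows "AE \<omega> in M. \<Phi> t \<omega> \<in> prob_simplex"
proof -
  let ?F = "observation M \<zeta> X t"
  let ?f = "\<lambda>i. indicator {\<omega>. \<alpha> t \<omega> = i} :: 'w \<Rightarrow> real"
  interpret prob_space M by fact
  interpret finite_measure_subalgebra M ?F
    by unfold_locales (rule subalgebra_observation[OF assms(2,3)])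
  have meas: "?f i \<in> borel_measurable M" for i
    using \<alpha> by (simp add: indicator_def)
  have int: "integrable M (?f i)" for i
    by (rule integrable_const_bound[where B = 1]) (auto simp: meas indicator_def)
  have eq: "AE \<omega> in M. \<forall>i. \<Phi> t \<omega> $ i = real_cond_exp M ?F (?f i) \<omega>"
    using filt t by (simp add: wonham_filter_def AE_all_countable)
  have pos: "AE \<omega> in M. \<forall>i. 0 \<le> real_cond_exp M ?F (?f i) \<omega>"
    by (simp add: AE_all_countable real_cond_exp_pos meas)
  have "(\<lambda>\<omega>. \<Sum>i\<in>UNIV. ?f i \<omega>) = (\<lambda>_. 1)"
    by (auto simp: indicator_def)
  then have "AE \<omega> in M. real_cond_exp M ?F (\<lambda>_. 1) \<omega> = (\<Sum>i\<in>UNIV. real_cond_exp M ?F (?f i) \<omega>)"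
    using real_cond_exp_sum[of ?f UNIV] int by simp
  moreover have "AE \<omega> in M. real_cond_exp M ?F (\<lambda>_. 1) \<omega> = 1"
    by (rule real_cond_exp_F_meas) auto
  ultimately show ?thesis
    using eq pos by eventually_elim (simp add: prob_simplex_def)
qed

text \<open>Almost surely the constraint holds at all rational times; it passes to all times before the
  lifetime because the paths are continuous and the simplex is closed.\<close>

lemma wonham_filter_prob_simplex_path:
  fixes \<alpha> :: "real \<Rightarrow> 'w \<Rightarrow> 'm::finite" and X :: "real \<Rightarrow> 'w \<Rightarrow> real ^ 'n"
  assumes "prob_space M" "\<zeta> \<in> borel_measurable M"
    and "\<And>t. 0 \<le> t \<Longrightarrow> X t \<in> borel_measurable M"
    and "\<And>t. 0 \<le> t \<Longrightarrow> \<alpha> t \<in> measurable M (count_space UNIV)"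
    and "wonham_filter M \<alpha> \<zeta> X \<Phi>"
    and cont: "AE \<omega> in M. continuous_on {t. 0 \<le> t \<and> ereal t < \<zeta> \<omega>} (\<lambda>t. \<Phi> t \<omega>)"
  shows "AE \<omega> in M. \<forall>t. 0 \<le> t \<and> ereal t < \<zeta> \<omega> \<longrightarrow> \<Phi> t \<omega> \<in> prob_simplex"
proof -
  have "AE \<omega> in M. \<forall>t\<in>\<rat> \<inter> {0..}. \<Phi> t \<omega> \<in> prob_simplex"
    by (subst AE_ball_countable)
      (auto intro: wonham_filter_prob_simplex[OF assms(1-4)] assms countable_Int1 countable_rat)
  with cont show ?thesis
  proof eventually_elim
    case (elim \<omega>)
    show ?case
    proof safe
      fix t assume t: "0 \<le> t" "ereal t < \<zeta> \<omega>"
      obtain r where r: "ereal t < ereal r" "ereal r < \<zeta> \<omega>"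
        using ereal_dense2[OF t(2)] by blast
      have "closure ({0<..<r} \<inter> \<rat>) = closure {0<..<r}"
        by (rule closure_open_Int_superset) (auto simp: Rats_closure_real)
      then have cl: "closure ({0<..<r} \<inter> \<rat>) = {0..r}"
        using r(1) t(1) by simp
      have "(\<lambda>t. \<Phi> t \<omega>) ` closure ({0<..<r} \<inter> \<rat>) \<subseteq> prob_simplex"
      proof (rule image_closure_subset)
        show "continuous_on (closure ({0<..<r} \<inter> \<rat>)) (\<lambda>t. \<Phi> t \<omega>)"
          unfolding cl
        proof (rule continuous_on_subset[OF elim(1)], safe)
          fix s assume "s \<in> {0..r}"
          then show "0 \<le> s" "ereal s < \<zeta> \<omega>"
            using r(2) le_less_trans[of "ereal s" "ereal r"] by auto
        qed
      qed (use elim(2) closed_prob_simplex in auto)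
      with cl t r show "\<Phi> t \<omega> \<in> prob_simplex" by auto
    qed
  qed
qed

section \<open>The estimate for a single path\<close>

text \<open>Gronwall's inequality is applied to \<open>1 + |x|\<close> instead of \<open>|x|\<close>, so that the drift bound is
  homogeneous.\<close>

lemma additive_noise_path_bound:
  fixes x b w :: "real \<Rightarrow> real ^ 'n"
  assumes "0 \<le> t" "0 \<le> c" and x: "continuous_on {0..t} x"
    and b: "set_integrable lborel {0..t} b"
    and growth: "\<And>s. 0 \<le> s \<Longrightarrow> s \<le> t \<Longrightarrow> norm (b s) \<le> c * (1 + norm (x s))"
    and w: "\<And>s. 0 \<le> s \<Longrightarrow> s \<le> t \<Longrightarrow> norm (w s) \<le> k"
    and eq: "\<And>s. 0 \<le> s \<Longrightarrow> s \<le> t \<Longrightarrow> x s = \<xi> + (LINT r:{0..s}|lborel. b r) + w s"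
  shows "norm (x t) \<le> (1 + norm \<xi> + k) * exp (c * t)"
proof -
  let ?g = "\<lambda>s. 1 + norm (x s)"
  have g: "continuous_on {0..t} ?g" by (intro continuous_intros x)
  have "?g t \<le> (1 + norm \<xi> + k) * exp (c * t)"
  proof (rule gronwall_integral[OF assms(1,2) g])
    fix s assume s: "0 \<le> s" "s \<le> t"
    have b': "set_integrable lborel {0..s} b"
      by (rule set_integrable_subset[OF b]) (use s in auto)
    have g': "set_integrable lborel {0..s} ?g"
      by (rule borel_integrable_atLeastAtMost', rule continuous_on_subset[OF g]) (use s in auto)
    have "norm (LINT r:{0..s}|lborel. b r) \<le> (LINT r:{0..s}|lborel. norm (b r))"
      by (rule set_integral_norm_bound[OF b'])
    also have "\<dots> \<le> (LINT r:{0..s}|lborel. c * ?g r)"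
      using s by (intro set_integral_mono set_integrable_norm b' set_integrable_mult_right g' growth) auto
    also have "\<dots> = c * integral {0..s} ?g"
      using set_borel_integral_eq_integral(2)[OF g'] by simp
    finally show "?g s \<le> 1 + norm \<xi> + k + c * integral {0..s} ?g"
      using norm_triangle_ineq[of "\<xi> + (LINT r:{0..s}|lborel. b r)" "w s"]
        norm_triangle_ineq[of \<xi> "LINT r:{0..s}|lborel. b r"] w[OF s] eq[OF s] by simp
  qed
  then show ?thesis by simp
qed

section \<open>Regularity\<close>

theorem theorem3p1:
  fixes M :: "'w measure"
    and A :: "'m::finite \<Rightarrow> real ^ 'n ^ 'n"
    and B :: "'m \<Rightarrow> real ^ 'd ^ 'n"
    and Q :: "real ^ 'm ^ 'm"
    and \<alpha> :: "real \<Rightarrow> 'w \<Rightarrow> 'm"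
    and W V X :: "real \<Rightarrow> 'w \<Rightarrow> real ^ 'n"
    and \<xi> :: "'w \<Rightarrow> real ^ 'n"
    and \<Phi> :: "real \<Rightarrow> 'w \<Rightarrow> real ^ 'm"
    and \<zeta> :: "'w \<Rightarrow> ereal"
    and u :: "real ^ 'n \<Rightarrow> real ^ 'm \<Rightarrow> real ^ 'd"
    and U :: "real \<Rightarrow> 'w \<Rightarrow> real ^ 'd"
    and Y :: "real \<Rightarrow> 'w \<Rightarrow> real ^ ('n + 'm)"
  defines "U \<equiv> \<lambda>t \<omega>. u (X t \<omega>) (\<Phi> t \<omega>)"
    and "Y \<equiv> \<lambda>t \<omega>. stack (X t \<omega>) (\<Phi> t \<omega>)"
  assumes "prob_space M"
    and "markov_chain M Q \<alpha>"
    and "brownian_motion M (natural_filtration M borel W) W"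
    and "\<xi> \<in> borel_measurable M"
    and "integrable M (\<lambda>\<omega>. (norm (\<xi> \<omega>))\<^sup>2)"
    and "mutually_independent M \<xi> \<alpha> W"
    and "explosion_time M Y \<zeta>"
    and "state_equation M A B \<alpha> W \<xi> \<zeta> U X"
    and "wonham_filter M \<alpha> \<zeta> X \<Phi>"
    and "innovation_equation M A B \<zeta> U X \<Phi> V"
    and "brownian_motion M (driving_filtration M \<zeta> X V) V"
    and "has_ito_differential M (driving_filtration M \<zeta> X V) V \<zeta>
           (\<lambda>t \<omega>. stack (C_matrix A B (X t \<omega>) (U t \<omega>) *v \<Phi> t \<omega>) (transpose Q *v \<Phi> t \<omega>))
           (\<lambda>t \<omega>. stack (mat 1)
              (D_matrix (\<Phi> t \<omega>) ** transpose (C_matrix A B (X t \<omega>) (U t \<omega>))))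
           Y"
    and "admissible M \<zeta> X U"
    and "linear_growth u"
  shows "regular M \<zeta> Y"
proof -
  have meas: "\<zeta> \<in> borel_measurable M" "\<And>t. 0 \<le> t \<Longrightarrow> X t \<in> borel_measurable M"
    "\<And>t. 0 \<le> t \<Longrightarrow> \<alpha> t \<in> measurable M (count_space UNIV)"
    using assms(4,9,10) by (auto simp: explosion_time_def state_equation_def markov_chain_def)
  have contY: "AE \<omega> in M. continuous_on {t. 0 \<le> t \<and> ereal t < \<zeta> \<omega>} (\<lambda>t. Y t \<omega>)"
    using assms(14) by (simp add: has_ito_differential_def)
  then have "AE \<omega> in M. continuous_on {t. 0 \<le> t \<and> ereal t < \<zeta> \<omega>} (\<lambda>t. \<Phi> t \<omega>)"
    by eventually_elim (auto simp: Y_def dest: continuous_on_stackD)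
  from wonham_filter_prob_simplex_path[OF assms(3) meas assms(11) this]
  have simplex: "AE \<omega> in M. \<forall>t. 0 \<le> t \<and> ereal t < \<zeta> \<omega> \<longrightarrow> \<Phi> t \<omega> \<in> prob_simplex" .
  obtain c where c: "0 \<le> c"
    "\<And>i x \<phi>. \<phi> \<in> prob_simplex \<Longrightarrow> norm (A i *v x + B i *v u x \<phi>) \<le> c * (1 + norm x)"
    using drift_linear_growth[OF assms(16)] by metis
  have contW: "AE \<omega> in M. continuous_on {0..} (\<lambda>t. W t \<omega>)"
    using assms(5) by (simp add: brownian_motion_def)
  have state: "AE \<omega> in M. \<forall>t. 0 \<le> t \<and> ereal t < \<zeta> \<omega> \<longrightarrow>
      set_integrable lborel {0..t} (\<lambda>s. A (\<alpha> s \<omega>) *v X s \<omega> + B (\<alpha> s \<omega>) *v U s \<omega>) \<and>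
      X t \<omega> = \<xi> \<omega> +
        (LINT s:{0..t}|lborel. A (\<alpha> s \<omega>) *v X s \<omega> + B (\<alpha> s \<omega>) *v U s \<omega>) + W t \<omega>"
    using assms(10) by (simp add: state_equation_def)
  have expl: "AE \<omega> in M. 0 < \<zeta> \<omega> \<and>
      (\<zeta> \<omega> < \<infinity> \<longrightarrow> (SUP t\<in>{t. 0 \<le> t \<and> ereal t < \<zeta> \<omega>}. ereal (norm (Y t \<omega>))) = \<infinity>)"
    using assms(9) by (simp add: explosion_time_def)
  have bound: "AE \<omega> in M. \<forall>T. \<exists>k. \<forall>t. 0 \<le> t \<and> t \<le> T \<and> ereal t < \<zeta> \<omega> \<longrightarrow> norm (Y t \<omega>) \<le> k"
    using contY simplex contW state
  proof eventually_elim
    case (elim \<omega>)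
    show ?case
    proof
      fix T :: real
      have "compact ((\<lambda>t. W t \<omega>) ` {0..T})"
        by (intro compact_continuous_image continuous_on_subset[OF elim(3)]) auto
      then obtain k where k: "\<And>t. 0 \<le> t \<Longrightarrow> t \<le> T \<Longrightarrow> norm (W t \<omega>) \<le> k"
        using compact_imp_bounded bounded_iff by (metis atLeastAtMost_iff image_eqI)
      have "norm (Y t \<omega>) \<le> (1 + norm (\<xi> \<omega>) + k) * exp (c * T) + 1"
        if t: "0 \<le> t" "t \<le> T" "ereal t < \<zeta> \<omega>" for t
      proof -
        have before: "ereal s < \<zeta> \<omega>" if "s \<le> t" for s
          using that t(3) le_less_trans[of "ereal s" "ereal t"] by simp
        have "norm (X t \<omega>) \<le> (1 + norm (\<xi> \<omega>) + k) * exp (c * t)"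
        proof (rule additive_noise_path_bound[OF t(1) c(1),
            where b = "\<lambda>s. A (\<alpha> s \<omega>) *v X s \<omega> + B (\<alpha> s \<omega>) *v U s \<omega>" and w = "\<lambda>s. W s \<omega>"])
          have "continuous_on {t. 0 \<le> t \<and> ereal t < \<zeta> \<omega>} (\<lambda>t. X t \<omega>)"
            using elim(1) by (auto simp: Y_def dest: continuous_on_stackD)
          then show "continuous_on {0..t} (\<lambda>t. X t \<omega>)"
            by (rule continuous_on_subset) (auto simp: before)
          show "set_integrable lborel {0..t} (\<lambda>s. A (\<alpha> s \<omega>) *v X s \<omega> + B (\<alpha> s \<omega>) *v U s \<omega>)"
            using elim(4) t by blast
          fix s assume s: "0 \<le> s" "s \<le> t"
          show "norm (A (\<alpha> s \<omega>) *v X s \<omega> + B (\<alpha> s \<omega>) *v U s \<omega>) \<le> c * (1 + norm (X s \<omega>))"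
            using c(2) elim(2) s before by (simp add: U_def)
          show "norm (W s \<omega>) \<le> k"
            using k s t by simp
          show "X s \<omega> = \<xi> \<omega> +
              (LINT r:{0..s}|lborel. A (\<alpha> r \<omega>) *v X r \<omega> + B (\<alpha> r \<omega>) *v U r \<omega>) + W s \<omega>"
            using elim(4) s before by blast
        qed
        also have "\<dots> \<le> (1 + norm (\<xi> \<omega>) + k) * exp (c * T)"
        proof -
          have "0 \<le> k" using k[OF t(1,2)] norm_ge_zero order_trans by blast
          then show ?thesis using c(1) t by (intro mult_left_mono) (auto intro: mult_left_mono)
        qed
        finally show ?thesis
          using norm_stack_le[of "X t \<omega>" "\<Phi> t \<omega>"] norm_prob_simplex_le elim(2) t
          by (fastforce simp: Y_def)
      qed
      then show "\<exists>k. \<forall>t. 0 \<le> t \<and> t \<le> T \<and> ereal t < \<zeta> \<omega> \<longrightarrow> norm (Y t \<omega>) \<le> k" by blast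
    qed
  qed
  show ?thesis
    unfolding regular_def
  proof (intro allI impI)
    fix T :: real assume "0 < T"
    show "AE \<omega> in M. \<not> (SUP t\<in>{0..T}. exploding_norm \<zeta> Y t \<omega>) = \<infinity>"
      using expl bound
    proof eventually_elim
      case (elim \<omega>)
      have inf: "\<zeta> \<omega> = \<infinity>"
      proof (rule ccontr)
        assume "\<zeta> \<omega> \<noteq> \<infinity>"
        with elim(1) obtain r where r: "\<zeta> \<omega> = ereal r" by (cases "\<zeta> \<omega>") auto
        obtain k where "\<And>t. 0 \<le> t \<Longrightarrow> t \<le> r \<Longrightarrow> ereal t < \<zeta> \<omega> \<Longrightarrow> norm (Y t \<omega>) \<le> k"
          using elim(2) by meson
        then have "(SUP t\<in>{t. 0 \<le> t \<and> ereal t < \<zeta> \<omega>}. ereal (norm (Y t \<omega>))) \<le> ereal k"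
          by (intro SUP_least) (auto simp: r)
        with elim(1) r show False by simp
      qed
      obtain k where "\<And>t. 0 \<le> t \<Longrightarrow> t \<le> T \<Longrightarrow> norm (Y t \<omega>) \<le> k"
        using elim(2) inf by fastforce
      then have "(SUP t\<in>{0..T}. exploding_norm \<zeta> Y t \<omega>) \<le> ereal k"
        by (intro SUP_least) (auto simp: exploding_norm_def inf)
      then show ?case by auto
    qed
  qed
qed

end
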